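(* Let $K$ be a field. The free 2-associative algebra $2as(K)$ on one generator is isomorphic to the 2-associative algebra $(T(\mathbb T_\infty),*,\cdot)$, where $T(\mathbb T_\infty)$ is the tensor algebra over $K[\mathbb T_\infty]$, $*$ is the concatenation product, and $\cdot$ is the product (with unit $1$) given on monomials in planar trees by \begin{align*} s\cdot t&=s^1\vee\cdots\vee s^m\vee t^1\vee\cdots\vee t^n,\\ (s_1*\cdots*s_k)\cdot t&=(s_1\vee\cdots\vee s_k)\vee t^1\vee\cdots\vee t^n\quad(k\ge2),\\ s\cdot(t_1*\cdots*t_l)&=s^1\vee\cdots\vee s^m\vee(t_1\vee\cdots\vee t_l)\quad(l\ge2),\\ (s_1*\cdots*s_k)\cdot(t_1*\cdots*t_l)&=(s_1\vee\cdots\vee s_k)\vee(t_1\vee\cdots\vee t_l)\quad(k,l\ge2), \end{align*} for planar trees $s=s^1\vee\cdots\vee s^m$, $t=t^1\vee\cdots\vee t^n$, $s_i$, $t_j$. Here the generator corresponds to the trivial tree $|$.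
   Context: A 2-associative algebra is a $K$-vector space with two associative products $*$ and $\cdot$ having a common unit $1$. $2as(K)$ is the free such algebra on one generator. $\mathbb T_n$ is the set of planar rooted trees with $n$ leaves in which every internal vertex has at least two inputs; $\mathbb T_1=\{|\}$ is the trivial tree (no vertex); $\mathbb T_\infty=\bigcup_{n\ge1}\mathbb T_n$. $K[\mathbb T_\infty]$ is the vector space with basis $\mathbb T_\infty$, and $T(\mathbb T_\infty)=T(K[\mathbb T_\infty])$ is the free unital associative algebra on it, with linear basis the monomials $t_1*\cdots*t_k$ ($k\ge0$, $t_i\in\mathbb T_\infty$). The grafting $t^1\vee\cdots\vee t^k$ is obtained by joining the $k$ roots to a new vertex and adding a new root. Any nontrivial planar tree is uniquely $t=t^1\vee\cdots\vee t^k$ with $k\ge2$ the valence of the root vertex; for $t=|$ the convention is $k=1$, $t^1=|$ in the formulas. *)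

theory Defs
  imports Complex_Main "HOL-Library.Poly_Mapping"
begin

section \<open>2-associative algebras\<close>

text \<open>
  Bilinearity of each product is expressed by linearity in each argument separately.
\<close>

locale two_assoc_algebra = vector_space scale
  for scale :: "'k::field \<Rightarrow> 'a::ab_group_add \<Rightarrow> 'a" +
  fixes star :: "'a \<Rightarrow> 'a \<Rightarrow> 'a"
    and dot :: "'a \<Rightarrow> 'a \<Rightarrow> 'a"
    and unit :: 'a
  assumes star_linear_right: "Vector_Spaces.linear scale scale (\<lambda>y. star x y)"
    and star_linear_left: "Vector_Spaces.linear scale scale (\<lambda>x. star x y)"
    and star_assoc: "star (star x y) z = star x (star y z)"
    and star_unit_left: "star unit x = x"
    and star_unit_right: "star x unit = x"
    and dot_linear_right: "Vector_Spaces.linear scale scale (\<lambda>y. dot x y)"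
    and dot_linear_left: "Vector_Spaces.linear scale scale (\<lambda>x. dot x y)"
    and dot_assoc: "dot (dot x y) z = dot x (dot y z)"
    and dot_unit_left: "dot unit x = x"
    and dot_unit_right: "dot x unit = x"

locale two_assoc_hom =
  dom: two_assoc_algebra scale1 star1 dot1 unit1 +
  cod: two_assoc_algebra scale2 star2 dot2 unit2 +
  Vector_Spaces.linear scale1 scale2 f
  for scale1 :: "'k::field \<Rightarrow> 'a::ab_group_add \<Rightarrow> 'a"
    and star1 dot1 unit1
    and scale2 :: "'k \<Rightarrow> 'b::ab_group_add \<Rightarrow> 'b"
    and star2 dot2 unit2
    and f :: "'a \<Rightarrow> 'b" +
  assumes hom_star: "f (star1 x y) = star2 (f x) (f y)"
    and hom_dot: "f (dot1 x y) = dot2 (f x) (f y)"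
    and hom_unit: "f unit1 = unit2"

locale two_assoc_iso = two_assoc_hom +
  assumes bij: "bij f"


section \<open>The free 2-associative algebra on one generator\<close>

text \<open>
  The algebra \<open>2as(K)\<close> is constructed as for any equational class: terms in one generator modulo
  the least congruence containing the axioms. Its universal property among all 2-associative
  algebras over the same field is proved in \<open>free_2as_universal\<close> below.
\<close>

datatype 'k two_as_term =
    TGen
  | TUnit
  | TZero
  | TAdd "'k two_as_term" "'k two_as_term"
  | TScale 'k "'k two_as_term"
  | TStar "'k two_as_term" "'k two_as_term"
  | TDot "'k two_as_term" "'k two_as_term"

inductive two_as_eq :: "'k::field two_as_term \<Rightarrow> 'k two_as_term \<Rightarrow> bool" where
  eq_refl: "two_as_eq x x"
| eq_sym: "two_as_eq x y \<Longrightarrow> two_as_eq y x"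
| eq_trans: "two_as_eq x y \<Longrightarrow> two_as_eq y z \<Longrightarrow> two_as_eq x z"
| cong_add: "two_as_eq x x' \<Longrightarrow> two_as_eq y y' \<Longrightarrow> two_as_eq (TAdd x y) (TAdd x' y')"
| cong_scale: "two_as_eq x x' \<Longrightarrow> two_as_eq (TScale a x) (TScale a x')"
| cong_star: "two_as_eq x x' \<Longrightarrow> two_as_eq y y' \<Longrightarrow> two_as_eq (TStar x y) (TStar x' y')"
| cong_dot: "two_as_eq x x' \<Longrightarrow> two_as_eq y y' \<Longrightarrow> two_as_eq (TDot x y) (TDot x' y')"
| ax_add_assoc: "two_as_eq (TAdd (TAdd x y) z) (TAdd x (TAdd y z))"
| ax_add_comm: "two_as_eq (TAdd x y) (TAdd y x)"
| ax_add_zero: "two_as_eq (TAdd TZero x) x"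
| ax_add_neg: "two_as_eq (TAdd (TScale (- 1) x) x) TZero"
| ax_scale_add: "two_as_eq (TScale a (TAdd x y)) (TAdd (TScale a x) (TScale a y))"
| ax_add_scale: "two_as_eq (TScale (a + b) x) (TAdd (TScale a x) (TScale b x))"
| ax_scale_scale: "two_as_eq (TScale a (TScale b x)) (TScale (a * b) x)"
| ax_scale_one: "two_as_eq (TScale 1 x) x"
| ax_star_assoc: "two_as_eq (TStar (TStar x y) z) (TStar x (TStar y z))"
| ax_star_unit_left: "two_as_eq (TStar TUnit x) x"
| ax_star_unit_right: "two_as_eq (TStar x TUnit) x"
| ax_star_add_left: "two_as_eq (TStar (TAdd x y) z) (TAdd (TStar x z) (TStar y z))"
| ax_star_add_right: "two_as_eq (TStar x (TAdd y z)) (TAdd (TStar x y) (TStar x z))"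
| ax_star_scale_left: "two_as_eq (TStar (TScale a x) y) (TScale a (TStar x y))"
| ax_star_scale_right: "two_as_eq (TStar x (TScale a y)) (TScale a (TStar x y))"
| ax_dot_assoc: "two_as_eq (TDot (TDot x y) z) (TDot x (TDot y z))"
| ax_dot_unit_left: "two_as_eq (TDot TUnit x) x"
| ax_dot_unit_right: "two_as_eq (TDot x TUnit) x"
| ax_dot_add_left: "two_as_eq (TDot (TAdd x y) z) (TAdd (TDot x z) (TDot y z))"
| ax_dot_add_right: "two_as_eq (TDot x (TAdd y z)) (TAdd (TDot x y) (TDot x z))"
| ax_dot_scale_left: "two_as_eq (TDot (TScale a x) y) (TScale a (TDot x y))"
| ax_dot_scale_right: "two_as_eq (TDot x (TScale a y)) (TScale a (TDot x y))"

quotient_type (overloaded) 'k free_2as = "'k::field two_as_term" / two_as_eq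
  by (rule equivpI) (auto intro: reflpI sympI transpI two_as_eq.intros(1-3))

instantiation free_2as :: (field) ab_group_add
begin

lift_definition zero_free_2as :: "'a free_2as" is TZero .

lift_definition plus_free_2as :: "'a free_2as \<Rightarrow> 'a free_2as \<Rightarrow> 'a free_2as" is TAdd
  by (rule cong_add)

lift_definition uminus_free_2as :: "'a free_2as \<Rightarrow> 'a free_2as" is "TScale (- 1)"
  by (rule cong_scale)

definition minus_free_2as :: "'a free_2as \<Rightarrow> 'a free_2as \<Rightarrow> 'a free_2as" where
  "minus_free_2as x y = x + (- y)"

instance
proof
  fix a b c :: "'a free_2as"
  show "a + b + c = a + (b + c)" by transfer (rule two_as_eq.intros)
  show "a + b = b + a" by transfer (rule two_as_eq.ax_add_comm)
  show "0 + a = a" by transfer (rule two_as_eq.intros)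
  show "- a + a = 0" by transfer (rule two_as_eq.intros)
  show "a - b = a + - b" by (rule minus_free_2as_def)
qed

end

lift_definition free_scale :: "'k::field \<Rightarrow> 'k free_2as \<Rightarrow> 'k free_2as" is TScale
  by (rule cong_scale)

lift_definition free_star :: "'k::field free_2as \<Rightarrow> 'k free_2as \<Rightarrow> 'k free_2as" is TStar
  by (rule cong_star)

lift_definition free_dot :: "'k::field free_2as \<Rightarrow> 'k free_2as \<Rightarrow> 'k free_2as" is TDot
  by (rule cong_dot)

lift_definition free_unit :: "'k::field free_2as" is TUnit .

lift_definition free_gen :: "'k::field free_2as" is TGen .

lemma vector_space_free_scale: "vector_space (free_scale :: 'k::field \<Rightarrow> _)"
proof
  fix a b :: 'k and x y :: "'k free_2as"
  show "free_scale a (x + y) = free_scale a x + free_scale a y"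
    by transfer (rule two_as_eq.ax_scale_add)
  show "free_scale (a + b) x = free_scale a x + free_scale b x"
    by transfer (rule two_as_eq.ax_add_scale)
  show "free_scale a (free_scale b x) = free_scale (a * b) x"
    by transfer (rule two_as_eq.ax_scale_scale)
  show "free_scale 1 x = x"
    by transfer (rule two_as_eq.ax_scale_one)
qed

lemma free_2as_algebra:
  "two_assoc_algebra (free_scale :: 'k::field \<Rightarrow> _) free_star free_dot free_unit"
proof -
  interpret vector_space "free_scale :: 'k \<Rightarrow> _" by (rule vector_space_free_scale)
  show ?thesis
  proof (unfold_locales, goal_cases)
    case 1 show ?case by transfer (rule two_as_eq.ax_star_add_right)
  next
    case 2 show ?case by transfer (rule two_as_eq.ax_star_scale_right)
  next
    case 3 show ?case by transfer (rule two_as_eq.ax_star_add_left)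
  next
    case 4 show ?case by transfer (rule two_as_eq.ax_star_scale_left)
  next
    case 5 show ?case by transfer (rule two_as_eq.ax_star_assoc)
  next
    case 6 show ?case by transfer (rule two_as_eq.ax_star_unit_left)
  next
    case 7 show ?case by transfer (rule two_as_eq.ax_star_unit_right)
  next
    case 8 show ?case by transfer (rule two_as_eq.ax_dot_add_right)
  next
    case 9 show ?case by transfer (rule two_as_eq.ax_dot_scale_right)
  next
    case 10 show ?case by transfer (rule two_as_eq.ax_dot_add_left)
  next
    case 11 show ?case by transfer (rule two_as_eq.ax_dot_scale_left)
  next
    case 12 show ?case by transfer (rule two_as_eq.ax_dot_assoc)
  next
    case 13 show ?case by transfer (rule two_as_eq.ax_dot_unit_left)
  next
    case 14 show ?case by transfer (rule two_as_eq.ax_dot_unit_right)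
  qed
qed

context two_assoc_algebra
begin

primrec eval_term :: "'a \<Rightarrow> 'k two_as_term \<Rightarrow> 'a" where
  "eval_term g TGen = g"
| "eval_term g TUnit = unit"
| "eval_term g TZero = 0"
| "eval_term g (TAdd x y) = eval_term g x + eval_term g y"
| "eval_term g (TScale a x) = scale a (eval_term g x)"
| "eval_term g (TStar x y) = star (eval_term g x) (eval_term g y)"
| "eval_term g (TDot x y) = dot (eval_term g x) (eval_term g y)"

lemmas star_bilinear_simps =
  module_hom.add[OF Vector_Spaces.linear.axioms(3)[OF star_linear_right]]
  module_hom.scale[OF Vector_Spaces.linear.axioms(3)[OF star_linear_right]]
  module_hom.add[OF Vector_Spaces.linear.axioms(3)[OF star_linear_left]]
  module_hom.scale[OF Vector_Spaces.linear.axioms(3)[OF star_linear_left]]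

lemmas dot_bilinear_simps =
  module_hom.add[OF Vector_Spaces.linear.axioms(3)[OF dot_linear_right]]
  module_hom.scale[OF Vector_Spaces.linear.axioms(3)[OF dot_linear_right]]
  module_hom.add[OF Vector_Spaces.linear.axioms(3)[OF dot_linear_left]]
  module_hom.scale[OF Vector_Spaces.linear.axioms(3)[OF dot_linear_left]]

lemma eval_term_eq: "two_as_eq s t \<Longrightarrow> eval_term g s = eval_term g t"
  by (induction rule: two_as_eq.induct)
    (simp_all add: star_bilinear_simps dot_bilinear_simps star_assoc dot_assoc
      star_unit_left star_unit_right dot_unit_left dot_unit_right
      scale_right_distrib scale_left_distrib add_ac)

theorem free_2as_universal:
  "\<exists>!f. two_assoc_hom free_scale free_star free_dot free_unit scale star dot unit f \<and>
        f free_gen = g"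
proof -
  interpret F: two_assoc_algebra "free_scale :: 'k \<Rightarrow> _" free_star free_dot free_unit
    by (rule free_2as_algebra)
  define h where "h x = eval_term g (rep_free_2as x)" for x
  have h: "h (abs_free_2as t) = eval_term g t" for t
    unfolding h_def by (rule eval_term_eq) (rule Quotient3_rep_abs[OF Quotient3_free_2as], rule eq_refl)
  have ops: "abs_free_2as s + abs_free_2as t = abs_free_2as (TAdd s t)"
    "free_scale a (abs_free_2as s) = abs_free_2as (TScale a s)"
    "free_star (abs_free_2as s) (abs_free_2as t) = abs_free_2as (TStar s t)"
    "free_dot (abs_free_2as s) (abs_free_2as t) = abs_free_2as (TDot s t)"
    for a :: 'k and s t
    by (simp_all add: plus_free_2as.abs_eq free_scale.abs_eq free_star.abs_eq free_dot.abs_eq)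
  have abs_cases: "\<exists>t. x = abs_free_2as t" for x :: "'k free_2as"
    by (metis Quotient3_abs_rep[OF Quotient3_free_2as])
  show ?thesis
  proof (rule ex1I[of _ h], intro conjI)
    show "two_assoc_hom free_scale free_star free_dot free_unit scale star dot unit h"
    proof (unfold_locales, goal_cases)
      case (1 x y)
      then show ?case using abs_cases[of x] abs_cases[of y] by (auto simp: ops h)
    next
      case (2 a x)
      then show ?case using abs_cases[of x] by (auto simp: ops h)
    next
      case (3 x y)
      then show ?case using abs_cases[of x] abs_cases[of y] by (auto simp: ops h)
    next
      case (4 x y)
      then show ?case using abs_cases[of x] abs_cases[of y] by (auto simp: ops h)
    next
      case 5
      then show ?case by (simp add: free_unit.abs_eq h)
    qed
    show "h free_gen = g" by (simp add: free_gen.abs_eq h)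
  next
    fix f
    assume f: "two_assoc_hom free_scale free_star free_dot free_unit scale star dot unit f \<and>
      f free_gen = g"
    then interpret f: two_assoc_hom free_scale free_star free_dot free_unit scale star dot unit f
      by blast
    have "f (abs_free_2as t) = eval_term g t" for t
    proof (induction t)
      case TGen
      then show ?case using f by (simp add: free_gen.abs_eq)
    next
      case TUnit
      then show ?case using f.hom_unit by (simp add: free_unit.abs_eq)
    next
      case TZero
      then show ?case using f.zero by (simp add: zero_free_2as.abs_eq)
    next
      case (TAdd s t)
      then show ?case by (simp add: f.add flip: ops)
    next
      case (TScale a t)
      then show ?case by (simp add: f.scale flip: ops)
    next
      case (TStar s t)
      then show ?case by (simp add: f.hom_star flip: ops)
    next
      case (TDot s t)
      then show ?case by (simp add: f.hom_dot flip: ops)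
    qed
    then show "f = h"
      using abs_cases h by (metis ext)
  qed
qed

end


section \<open>Planar rooted trees\<close>

text \<open>
  \<open>Trivial\<close> is the tree \<open>|\<close> without vertex; \<open>Vertex t\<^sub>1 t\<^sub>2 ts\<close> has root vertex with the ordered
  inputs \<open>t\<^sub>1, t\<^sub>2\<close> followed by \<open>ts\<close>. Hence every vertex has at least two inputs, and the type is
  the set \<open>\<T>\<^sub>\<infinity>\<close> of all planar trees.
\<close>

datatype tree = Trivial | Vertex tree tree "tree list"

text \<open>
  \<open>graft [t\<^sub>1, \<dots>, t\<^sub>k]\<close> is \<open>t\<^sub>1 \<or> \<dots> \<or> t\<^sub>k\<close>. It is only meaningful, and only used,
  for \<open>k \<ge> 2\<close>.
\<close>

fun graft :: "tree list \<Rightarrow> tree" where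
  "graft (t1 # t2 # ts) = Vertex t1 t2 ts"

text \<open>\<open>branches t\<close> is the list \<open>[t\<^sup>1, \<dots>, t\<^sup>n]\<close>, with the convention \<open>|\<^sup>1 = |\<close>.\<close>

fun branches :: "tree \<Rightarrow> tree list" where
  "branches Trivial = [Trivial]"
| "branches (Vertex t1 t2 ts) = t1 # t2 # ts"

lemma graft_branches: "t \<noteq> Trivial \<Longrightarrow> graft (branches t) = t"
  by (cases t) auto

lemma branches_graft: "length ts \<ge> 2 \<Longrightarrow> branches (graft ts) = ts"
  by (cases ts rule: graft.cases) auto


section \<open>The tensor algebra on planar trees\<close>

text \<open>
  The list \<open>[t\<^sub>1, \<dots>, t\<^sub>k]\<close> stands for the basis monomial \<open>t\<^sub>1 * \<dots> * t\<^sub>k\<close> of the tensor algebra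
  on the vector space with basis \<open>\<T>\<^sub>\<infinity>\<close>, the empty list for \<open>1\<close>.
\<close>

type_synonym 'k tree_tensor = "tree list \<Rightarrow>\<^sub>0 'k"

definition tensor_scale :: "'k::field \<Rightarrow> 'k tree_tensor \<Rightarrow> 'k tree_tensor" where
  "tensor_scale a x = Poly_Mapping.map (\<lambda>b. a * b) x"

definition monomial :: "tree list \<Rightarrow> 'k::field tree_tensor" where
  "monomial u = Poly_Mapping.single u 1"

definition bilinear_extension ::
  "(tree list \<Rightarrow> tree list \<Rightarrow> tree list) \<Rightarrow>
    'k::field tree_tensor \<Rightarrow> 'k tree_tensor \<Rightarrow> 'k tree_tensor" where
  "bilinear_extension m x y =
    (\<Sum>u\<in>Poly_Mapping.keys x. \<Sum>v\<in>Poly_Mapping.keys y.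
       tensor_scale (Poly_Mapping.lookup x u * Poly_Mapping.lookup y v) (monomial (m u v)))"

fun dot_monomial :: "tree list \<Rightarrow> tree list \<Rightarrow> tree list" where
  "dot_monomial [] v = v"
| "dot_monomial u [] = u"
| "dot_monomial [s] [t] = [graft (branches s @ branches t)]"
| "dot_monomial (s1 # s2 # ss) [t] = [graft (graft (s1 # s2 # ss) # branches t)]"
| "dot_monomial [s] (t1 # t2 # ts) = [graft (branches s @ [graft (t1 # t2 # ts)])]"
| "dot_monomial (s1 # s2 # ss) (t1 # t2 # ts) =
    [graft [graft (s1 # s2 # ss), graft (t1 # t2 # ts)]]"

definition tensor_star :: "'k::field tree_tensor \<Rightarrow> 'k tree_tensor \<Rightarrow> 'k tree_tensor" where
  "tensor_star = bilinear_extension (@)"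

definition tensor_dot :: "'k::field tree_tensor \<Rightarrow> 'k tree_tensor \<Rightarrow> 'k tree_tensor" where
  "tensor_dot = bilinear_extension dot_monomial"

definition tensor_unit :: "'k::field tree_tensor" where
  "tensor_unit = monomial []"

end

theory Submission
  imports Defs
begin

text \<open>
  Every monomial in trees is a \<open>\<cdot>\<close>-product in a unique way: a single tree \<open>t\<close> is the product of
  its branches, each branch \<open>t\<^sub>1 \<or> \<dots> \<or> t\<^sub>k\<close> being read as the monomial \<open>t\<^sub>1 * \<dots> * t\<^sub>k\<close>, and a longer
  monomial is \<open>\<cdot>\<close>-indecomposable. Reading trees alternately as \<open>*\<close>- and \<open>\<cdot>\<close>-products thus evaluates
  monomials in any 2-associative algebra with a chosen element, and this evaluation respects both
  products. Evaluation in the free algebra is inverse to the homomorphism given by its universal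
  property.
\<close>

section \<open>The dot product on monomials\<close>

text \<open>
  This is an isomorphism from monomials with \<open>dot_monomial\<close> to lists of trees with concatenation.
\<close>

fun dot_factors :: "tree list \<Rightarrow> tree list" where
  "dot_factors [] = []"
| "dot_factors [t] = branches t"
| "dot_factors (t1 # t2 # ts) = [graft (t1 # t2 # ts)]"

lemma dot_factors_branches [simp]: "dot_factors (branches t) = [t]"
  by (cases t) auto

text \<open>The clauses have disjoint ranges: a nontrivial tree has at least two branches,
  \<open>branches Trivial\<close> is \<open>[Trivial]\<close>, and a longer monomial gives a single
  nontrivial tree. Within a clause the tree or monomial is recovered from its branches or
  graft.\<close>

lemma dot_factors_inject:
  assumes "dot_factors u = dot_factors v"
  shows "u = v"
proof -
  have "branches s \<noteq> []" "branches s = [t] \<longleftrightarrow> s = Trivial \<and> t = Trivial"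
    "branches s = branches t \<longleftrightarrow> s = t" for s t
    by (cases s; cases t; auto)+
  then show ?thesis
    using assms by (cases u rule: dot_factors.cases; cases v rule: dot_factors.cases)
      (auto dest: sym[of "[_]"] sym[of "[]"])
qed

text \<open>A single tree contributes its branches and a longer monomial its graft, so the new root
  carries both factor lists side by side.\<close>

lemma dot_factors_dot_monomial [simp]:
  "dot_factors (dot_monomial u v) = dot_factors u @ dot_factors v"
proof -
  \<comment> \<open>Each graft has at least two inputs, as \<open>branches_graft\<close>
    requires.\<close>
  have "length (branches s @ branches t) \<ge> 2" "length (branches s @ [t]) \<ge> 2"
    "length (t # branches s) \<ge> 2" for s t
    by (cases s; cases t; simp)+
  then show ?thesis
    by (cases "(u, v)" rule: dot_monomial.cases) (simp_all add: branches_graft del: graft.simps)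
qed

text \<open>Pulled back from list concatenation along the injective \<open>dot_factors\<close>,
  which avoids a case analysis on three lengths.\<close>

lemma dot_monomial_assoc: "dot_monomial (dot_monomial u v) w = dot_monomial u (dot_monomial v w)"
  by (rule dot_factors_inject) simp

lemma dot_monomial_Nil_right [simp]: "dot_monomial u [] = u"
  by (rule dot_factors_inject) simp


section \<open>Linear extension from monomials\<close>

lemma lookup_tensor_scale [simp]:
  "Poly_Mapping.lookup (tensor_scale a x) u = a * Poly_Mapping.lookup x u"
  by (simp add: tensor_scale_def map.rep_eq when_def)

lemma vector_space_tensor_scale: "vector_space tensor_scale"
  by unfold_locales (auto intro!: poly_mapping_eqI simp: lookup_add algebra_simps)

definition linear_extension ::
  "('k::field \<Rightarrow> 'b::ab_group_add \<Rightarrow> 'b) \<Rightarrow> (tree list \<Rightarrow> 'b) \<Rightarrow> 'k tree_tensor \<Rightarrow> 'b" where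
  "linear_extension scale f x =
    (\<Sum>u\<in>Poly_Mapping.keys x. scale (Poly_Mapping.lookup x u) (f u))"

text \<open>Allows a common index set for tensors with different supports, such as \<open>x\<close>,
  \<open>y\<close> and \<open>x + y\<close>.\<close>

lemma linear_extension_superset:
  assumes "vector_space scale" "finite U" "Poly_Mapping.keys x \<subseteq> U"
  shows "linear_extension scale f x = (\<Sum>u\<in>U. scale (Poly_Mapping.lookup x u) (f u))"
proof -
  interpret vector_space scale by fact
  show ?thesis
    unfolding linear_extension_def
    using assms(2,3) by (intro sum.mono_neutral_left) (auto simp: in_keys_iff)
qed

lemma linear_linear_extension:
  fixes scale :: "'k::field \<Rightarrow> 'b::ab_group_add \<Rightarrow> 'b"
  assumes "vector_space scale"
  shows "Vector_Spaces.linear tensor_scale scale (linear_extension scale f)"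
proof -
  interpret T: vector_space tensor_scale by (rule vector_space_tensor_scale)
  interpret vector_space scale by fact
  show ?thesis
  proof (unfold_locales)
    fix x y :: "'k tree_tensor" and a
    let ?U = "Poly_Mapping.keys x \<union> Poly_Mapping.keys y"
    have "linear_extension scale f z = (\<Sum>u\<in>?U. scale (Poly_Mapping.lookup z u) (f u))"
      if "Poly_Mapping.keys z \<subseteq> ?U" for z :: "'k tree_tensor"
      using that by (intro linear_extension_superset assms) auto
    then show "linear_extension scale f (x + y)
        = linear_extension scale f x + linear_extension scale f y"
      using Poly_Mapping.keys_add[of x y]
      by (simp add: lookup_add scale_left_distrib sum.distrib)
    have "linear_extension scale f (tensor_scale a x)
        = (\<Sum>u\<in>Poly_Mapping.keys x. scale (Poly_Mapping.lookup (tensor_scale a x) u) (f u))"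
      by (intro linear_extension_superset assms) (auto simp: in_keys_iff)
    then show "linear_extension scale f (tensor_scale a x) = scale a (linear_extension scale f x)"
      by (simp add: linear_extension_def scale_sum_right)
  qed
qed

lemma linear_extension_monomial:
  "vector_space scale \<Longrightarrow> linear_extension scale f (monomial u) = f u"
  by (simp add: linear_extension_def monomial_def vector_space.vector_space_assms(4))

text \<open>Linearity in the prescribed values, with the tensor fixed; this yields linearity of a
  bilinear extension in its right argument.\<close>

lemma linear_linear_extension_values:
  assumes "\<And>u. Vector_Spaces.linear s scale (\<lambda>y. f y u)"
  shows "Vector_Spaces.linear s scale (\<lambda>y. linear_extension scale (f y) x)"
proof -
  interpret f: Vector_Spaces.linear s scale "\<lambda>y. f y u" for u by (rule assms)
  show ?thesis
    by unfold_locales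
      (simp_all add: linear_extension_def f.add f.scale f.vs2.scale_right_distrib sum.distrib
        f.vs2.scale_sum_right mult.commute)
qed

lemma tensor_expansion:
  fixes x :: "'k::field tree_tensor"
  shows "x = (\<Sum>u\<in>Poly_Mapping.keys x. tensor_scale (Poly_Mapping.lookup x u) (monomial u))"
  by (rule poly_mapping_eqI)
    (auto simp: lookup_sum monomial_def lookup_single when_def if_distrib in_keys_iff cong: if_cong)

lemma linear_eq_on_monomials:
  assumes "Vector_Spaces.linear tensor_scale s f" "Vector_Spaces.linear tensor_scale s g"
    and "\<And>u. f (monomial u) = g (monomial u)"
  shows "f x = g x"
proof -
  interpret f: Vector_Spaces.linear tensor_scale s f by fact
  interpret g: Vector_Spaces.linear tensor_scale s g by fact
  show ?thesis
    by (subst (1 2) tensor_expansion[of x]) (simp add: f.sum g.sum f.scale g.scale assms(3))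
qed

lemma linear_compose':
  assumes "Vector_Spaces.linear s1 s2 f" "Vector_Spaces.linear s2 s3 g"
  shows "Vector_Spaces.linear s1 s3 (\<lambda>x. g (f x))"
  using Vector_Spaces.linear_compose[OF assms] by (simp add: comp_def)

section \<open>Bilinear extensions and the 2-associative structure on tensors\<close>

lemma bilinear_extension_eq:
  "bilinear_extension m x y = linear_extension tensor_scale
     (\<lambda>u. linear_extension tensor_scale (\<lambda>v. monomial (m u v)) y) x"
proof -
  interpret T: vector_space tensor_scale by (rule vector_space_tensor_scale)
  show ?thesis
    by (simp add: bilinear_extension_def linear_extension_def T.scale_sum_right)
qed

lemma bilinear_extension_monomial [simp]:
  "bilinear_extension m (monomial u) (monomial v) = monomial (m u v)"
  by (simp add: bilinear_extension_eq
      linear_extension_monomial[OF vector_space_tensor_scale])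

lemma linear_bilinear_extension_left:
  "Vector_Spaces.linear tensor_scale tensor_scale (\<lambda>x. bilinear_extension m x y)"
  unfolding bilinear_extension_eq
  by (rule linear_linear_extension[OF vector_space_tensor_scale])

lemma linear_bilinear_extension_right:
  "Vector_Spaces.linear tensor_scale tensor_scale (\<lambda>y. bilinear_extension m x y)"
  unfolding bilinear_extension_eq
  by (intro linear_linear_extension_values linear_linear_extension
      vector_space_tensor_scale)

lemma tensor_linear_ident: "Vector_Spaces.linear tensor_scale tensor_scale (\<lambda>x. x)"
  using vector_space.linear_id[OF vector_space_tensor_scale] by (simp add: id_def)

text \<open>Both sides are trilinear, so monomials suffice; the arguments \<open>z\<close>,
  \<open>y\<close>, \<open>x\<close> are made general one after the other.\<close>

lemma bilinear_extension_assoc: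
  assumes "\<And>u v w. m (m u v) w = m u (m v w)"
  shows "bilinear_extension m (bilinear_extension m x y) z
    = bilinear_extension m x (bilinear_extension m y z)"
proof -
  note left = linear_bilinear_extension_left[of m] and right = linear_bilinear_extension_right[of m]
  have 1: "bilinear_extension m (bilinear_extension m (monomial u) (monomial v)) z
    = bilinear_extension m (monomial u) (bilinear_extension m (monomial v) z)" for u v z
    by (rule linear_eq_on_monomials[where s = tensor_scale and x = z])
      (rule right, rule linear_compose'[OF right right], simp add: assms)
  have 2: "bilinear_extension m (bilinear_extension m (monomial u) y) z
    = bilinear_extension m (monomial u) (bilinear_extension m y z)" for u y z
    by (rule linear_eq_on_monomials[where s = tensor_scale and x = y])
      (rule linear_compose'[OF right left], rule linear_compose'[OF left right], rule 1)
  show ?thesis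
    by (rule linear_eq_on_monomials[where s = tensor_scale and x = x])
      (rule linear_compose'[OF left left], rule left, rule 2)
qed

lemma bilinear_extension_unit:
  assumes "\<And>u. m [] u = u" "\<And>u. m u [] = u"
  shows "bilinear_extension m (monomial []) x = x" "bilinear_extension m x (monomial []) = x"
  by (rule linear_eq_on_monomials[where s = tensor_scale and x = x],
      rule linear_bilinear_extension_left linear_bilinear_extension_right,
      rule tensor_linear_ident, simp add: assms)+

lemma tensor_two_assoc_algebra:
  "two_assoc_algebra tensor_scale tensor_star tensor_dot tensor_unit"
  unfolding tensor_star_def tensor_dot_def tensor_unit_def
  by (intro two_assoc_algebra.intro two_assoc_algebra_axioms.intro vector_space_tensor_scale
      linear_bilinear_extension_left linear_bilinear_extension_right bilinear_extension_assoc
      bilinear_extension_unit dot_monomial_assoc) simp_all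


section \<open>Evaluation of trees and monomials\<close>

text \<open>
  The first operation belongs to the root vertex; passing to the inputs of a vertex exchanges the
  two operations.
\<close>

fun tree_eval :: "('a \<Rightarrow> 'a \<Rightarrow> 'a) \<Rightarrow> ('a \<Rightarrow> 'a \<Rightarrow> 'a) \<Rightarrow> 'a \<Rightarrow> 'a \<Rightarrow> tree \<Rightarrow> 'a" where
  "tree_eval m m' e g Trivial = g"
| "tree_eval m m' e g (Vertex t1 t2 ts) =
    m (tree_eval m' m e g t1) (m (tree_eval m' m e g t2) (foldr m (map (tree_eval m' m e g) ts) e))"

lemma tree_eval_hom:
  assumes "\<And>x y. f (m x y) = n (f x) (f y)" "\<And>x y. f (m' x y) = n' (f x) (f y)"
  shows "f (tree_eval m m' e g t) = tree_eval n n' (f e) (f g) t"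
proof -
  have fold: "f (foldr p xs e) = foldr q (map f xs) (f e)"
    if "\<And>x y. f (p x y) = q (f x) (f y)" for p q xs
    by (induction xs) (simp_all add: that)
  show ?thesis
    \<comment> \<open>The operations are generalised because the induction hypothesis is applied
      with the two exchanged.\<close>
    using assms
    by (induction t arbitrary: m m' n n') (simp_all add: fold cong: map_cong)
qed

text \<open>The list itself is the outer \<open>star\<close>-product, so the root vertices of its
  trees stand for \<open>dot\<close>.\<close>

definition monomial_eval :: "('a \<Rightarrow> 'a \<Rightarrow> 'a) \<Rightarrow> ('a \<Rightarrow> 'a \<Rightarrow> 'a) \<Rightarrow> 'a \<Rightarrow> 'a \<Rightarrow> tree list \<Rightarrow> 'a" where
  "monomial_eval star dot e g u = foldr star (map (tree_eval dot star e g) u) e"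

context two_assoc_algebra
begin

abbreviation meval :: "'a \<Rightarrow> tree list \<Rightarrow> 'a" where
  "meval \<equiv> monomial_eval star dot unit"

lemma monomial_eval_append: "meval g (u @ v) = star (meval g u) (meval g v)"
  by (induction u) (simp_all add: monomial_eval_def star_assoc star_unit_left)

text \<open>A single tree is already read as the \<open>dot\<close>-product of its branches; a
  longer monomial has the value of its graft with \<open>star\<close> at the root.\<close>

lemma monomial_eval_eq_dot_factors:
  "meval g u = foldr dot (map (tree_eval star dot unit g) (dot_factors u)) unit"
proof -
  have "tree_eval dot star unit g t
      = foldr dot (map (tree_eval star dot unit g) (branches t)) unit" for t
    by (cases t) (simp_all add: dot_unit_right)
  then show ?thesis
    by (cases u rule: dot_factors.cases)
      (simp_all add: monomial_eval_def dot_unit_right star_unit_right)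
qed

text \<open>In terms of \<open>dot_factors\<close>, this is the analogue of
  \<open>monomial_eval_append\<close> with the operations exchanged.\<close>

lemma monomial_eval_dot_monomial: "meval g (dot_monomial u v) = dot (meval g u) (meval g v)"
proof -
  have "foldr dot (xs @ ys) unit = dot (foldr dot xs unit) (foldr dot ys unit)" for xs ys
    by (induction xs) (simp_all add: dot_assoc dot_unit_left del: foldr_append)
  then show ?thesis
    by (simp add: monomial_eval_eq_dot_factors del: foldr_append)
qed

lemma linear_extension_bilinear_extension:
  assumes "\<And>y. Vector_Spaces.linear scale scale (\<lambda>x. p x y)"
    and "\<And>x. Vector_Spaces.linear scale scale (p x)"
    and "\<And>u v. f (m u v) = p (f u) (f v)"
  shows "linear_extension scale f (bilinear_extension m x y)
    = p (linear_extension scale f x) (linear_extension scale f y)"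
proof -
  note ext = linear_linear_extension[OF vector_space_axioms, of f]
  have 1: "linear_extension scale f (bilinear_extension m (monomial u) y)
    = p (linear_extension scale f (monomial u)) (linear_extension scale f y)" for u
    by (rule linear_eq_on_monomials[where s = scale and x = y])
      (rule linear_compose'[OF linear_bilinear_extension_right ext],
        rule linear_compose'[OF ext assms(2)],
        simp add: assms(3) linear_extension_monomial[OF vector_space_axioms])
  show ?thesis
    by (rule linear_eq_on_monomials[where s = scale and x = x])
      (rule linear_compose'[OF linear_bilinear_extension_left ext],
        rule linear_compose'[OF ext assms(1)], rule 1)
qed

text \<open>The existence half of freeness of the tensor algebra: this map sends
  \<open>monomial [Trivial]\<close> to \<open>g\<close>.\<close>

lemma two_assoc_hom_linear_extension:
  "two_assoc_hom tensor_scale tensor_star tensor_dot tensor_unit scale star dot unit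
     (linear_extension scale (meval g))"
proof (intro two_assoc_hom.intro two_assoc_hom_axioms.intro)
  fix x y :: "'k tree_tensor"
  show "linear_extension scale (meval g) (tensor_star x y)
      = star (linear_extension scale (meval g) x) (linear_extension scale (meval g) y)"
    unfolding tensor_star_def
    by (intro linear_extension_bilinear_extension star_linear_left star_linear_right
        monomial_eval_append)
  show "linear_extension scale (meval g) (tensor_dot x y)
      = dot (linear_extension scale (meval g) x) (linear_extension scale (meval g) y)"
    unfolding tensor_dot_def
    by (intro linear_extension_bilinear_extension dot_linear_left dot_linear_right
        monomial_eval_dot_monomial)
  show "linear_extension scale (meval g) tensor_unit = unit"
    by (simp add: tensor_unit_def monomial_eval_def
        linear_extension_monomial[OF vector_space_axioms])
qed (rule tensor_two_assoc_algebra two_assoc_algebra_axioms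
    linear_linear_extension[OF vector_space_axioms])+

end

section \<open>Evaluation at the trivial tree inside the tensor algebra\<close>

lemma tensor_star_monomial: "tensor_star (monomial u) (monomial v) = monomial (u @ v)"
  by (simp add: tensor_star_def)

lemma tensor_dot_monomial: "tensor_dot (monomial u) (monomial v) = monomial (dot_monomial u v)"
  by (simp add: tensor_dot_def)

text \<open>Both readings are proved together, since each one at a vertex uses the other at the
  inputs.\<close>

lemma tree_eval_tensor:
  fixes g :: "'k::field tree_tensor"
  defines "g \<equiv> monomial [Trivial]"
  shows "tree_eval tensor_dot tensor_star tensor_unit g t = monomial [t]"
    "tree_eval tensor_star tensor_dot tensor_unit g t = monomial (branches t)"
proof (induction t)
  case (Vertex t1 t2 ts)
  have star: "foldr tensor_star (map (\<lambda>t. monomial [t]) us) tensor_unit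
      = (monomial us :: 'k tree_tensor)" for us
    by (induction us) (simp_all add: tensor_unit_def tensor_star_monomial)
  have dot: "foldr tensor_dot (map (\<lambda>t. monomial (branches t)) us) tensor_unit
      = (monomial (foldr dot_monomial (map branches us) []) :: 'k tree_tensor)" for us
    by (induction us) (simp_all add: tensor_unit_def tensor_dot_monomial)
  have factors: "dot_factors (foldr dot_monomial (map branches us) []) = us" for us
    by (induction us) simp_all
  \<comment> \<open>Both sides have the factors \<open>t1 # t2 # ts\<close>.\<close>
  have "dot_monomial (branches t1)
      (dot_monomial (branches t2) (foldr dot_monomial (map branches ts) [])) = [Vertex t1 t2 ts]"
    by (rule dot_factors_inject) (simp add: factors)
  with Vertex star dot
  show "tree_eval tensor_dot tensor_star tensor_unit g (Vertex t1 t2 ts)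
      = monomial [Vertex t1 t2 ts]"
    "tree_eval tensor_star tensor_dot tensor_unit g (Vertex t1 t2 ts)
      = monomial (branches (Vertex t1 t2 ts))"
    by (simp_all add: tensor_star_monomial tensor_dot_monomial cong: map_cong)
qed (simp_all add: g_def)

lemma monomial_eval_tensor:
  "monomial_eval tensor_star tensor_dot tensor_unit (monomial [Trivial]) u = monomial u"
  by (induction u)
    (simp_all add: monomial_eval_def tree_eval_tensor tensor_star_monomial flip: tensor_unit_def)

theorem theorem5p4:
  shows "two_assoc_algebra (tensor_scale :: 'k::field \<Rightarrow> 'k tree_tensor \<Rightarrow> 'k tree_tensor)
           tensor_star tensor_dot tensor_unit \<and>
         (\<exists>\<phi> :: 'k free_2as \<Rightarrow> 'k tree_tensor.
            two_assoc_iso free_scale free_star free_dot free_unit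
              tensor_scale tensor_star tensor_dot tensor_unit \<phi> \<and>
            \<phi> free_gen = monomial [Trivial])"
proof (intro conjI tensor_two_assoc_algebra)
  interpret F: two_assoc_algebra "free_scale :: 'k \<Rightarrow> _" free_star free_dot free_unit
    by (rule free_2as_algebra)
  interpret T: two_assoc_algebra "tensor_scale :: 'k \<Rightarrow> _" tensor_star tensor_dot tensor_unit
    by (rule tensor_two_assoc_algebra)
  obtain \<phi> :: "'k free_2as \<Rightarrow> 'k tree_tensor"
    where hom: "two_assoc_hom free_scale free_star free_dot free_unit
        tensor_scale tensor_star tensor_dot tensor_unit \<phi>"
      and gen: "\<phi> free_gen = monomial [Trivial]"
    using T.free_2as_universal[of "monomial [Trivial]"] by blast
  \<comment> \<open>The inverse can be given explicitly, because monomials form a basis of the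
    tensor algebra.\<close>
  define \<psi> :: "'k tree_tensor \<Rightarrow> 'k free_2as"
    where "\<psi> = linear_extension free_scale (F.meval free_gen)"
  interpret \<phi>: two_assoc_hom "free_scale :: 'k \<Rightarrow> _" free_star free_dot free_unit
    tensor_scale tensor_star tensor_dot tensor_unit \<phi> by (rule hom)
  interpret \<psi>: two_assoc_hom "tensor_scale :: 'k \<Rightarrow> _" tensor_star tensor_dot tensor_unit
    free_scale free_star free_dot free_unit \<psi>
    unfolding \<psi>_def by (rule F.two_assoc_hom_linear_extension)
  have "\<phi> (\<psi> (monomial u)) = monomial u" for u
  proof -
    \<comment> \<open>Homomorphisms commute with evaluation, and a monomial evaluated at the trivial
      tree is itself.\<close>
    have "\<phi> (F.meval free_gen u) = T.meval (\<phi> free_gen) u"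
      by (induction u)
        (simp_all add: monomial_eval_def \<phi>.hom_star \<phi>.hom_dot \<phi>.hom_unit tree_eval_hom[where f = \<phi>])
    then show ?thesis
      by (simp add: \<psi>_def gen monomial_eval_tensor
          linear_extension_monomial[OF F.vector_space_axioms])
  qed
  then have \<phi>\<psi>: "\<phi> (\<psi> x) = x" for x
    using linear_eq_on_monomials[OF linear_compose'[OF \<psi>.linear_axioms \<phi>.linear_axioms]
        tensor_linear_ident] by blast
  have "\<psi> (\<phi> free_gen) = free_gen"
    by (simp add: gen \<psi>_def monomial_eval_def F.star_unit_right
        linear_extension_monomial[OF F.vector_space_axioms])
  \<comment> \<open>The composite and the identity are endomorphisms fixing the generator, so
    uniqueness in the universal property identifies them.\<close>
  moreover have "two_assoc_hom free_scale free_star free_dot free_unit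
      free_scale free_star free_dot free_unit (\<lambda>x. \<psi> (\<phi> x))"
    by unfold_locales
      (simp_all add: \<phi>.add \<phi>.scale \<psi>.add \<psi>.scale \<phi>.hom_star \<phi>.hom_dot \<phi>.hom_unit
        \<psi>.hom_star \<psi>.hom_dot \<psi>.hom_unit)
  moreover have "two_assoc_hom free_scale free_star free_dot free_unit
      free_scale free_star free_dot free_unit (\<lambda>x :: 'k free_2as. x)"
    by unfold_locales simp_all
  ultimately have "(\<lambda>x. \<psi> (\<phi> x)) = (\<lambda>x. x)"
    using F.free_2as_universal[of free_gen] by blast
  then have "\<psi> (\<phi> x) = x" for x
    by (rule fun_cong)
  with \<phi>\<psi> have "bij \<phi>"
    by (metis bijI')
  then have "two_assoc_iso free_scale free_star free_dot free_unit
      tensor_scale tensor_star tensor_dot tensor_unit \<phi>"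
    by (intro two_assoc_iso.intro two_assoc_iso_axioms.intro hom)
  with gen show "\<exists>\<phi> :: 'k free_2as \<Rightarrow> 'k tree_tensor.
      two_assoc_iso free_scale free_star free_dot free_unit
        tensor_scale tensor_star tensor_dot tensor_unit \<phi> \<and>
      \<phi> free_gen = monomial [Trivial]"
    by blast
qed

end
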